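(* Let $k$ be a field of characteristic $0$, let $V$ be a $k$-vector space of dimension $2$, identified with $k^2$ by a choice of basis, and let $(v_{i,j})_{1\leq i<j\leq 4}\in V^6$. (a) If $T:V\to V$ is a linear map, then $$det^{S^2}\big((T(v_{i,j}))_{1\leq i<j\leq 4}\big)=\det(T)^3\, det^{S^2}\big((v_{i,j})_{1\leq i<j\leq 4}\big).$$ In particular, $det^{S^2}$ is invariant under the (diagonal) action of the group $SL_2(k)$ on $V^6$. (b) For any permutation $\sigma\in S_4$, $$det^{S^2}\big(\sigma\cdot (v_{i,j})_{1\leq i<j\leq 4}\big)=\mathrm{sgn}(\sigma)\, det^{S^2}\big((v_{i,j})_{1\leq i<j\leq 4}\big).$$
   Context: Elements of $V^6$ are indexed by pairs $1\leq i<j\leq 4$ and written $(v_{i,j})_{1\leq i<j\leq 4}$. For $\sigma\in S_4$, $\sigma\cdot (v_{i,j})_{1\leq i<j\leq 4}$ is the element of $V^6$ whose entry in position $(i,j)$, $1\leq i<j\leq 4$, is $v_{\sigma(i),\sigma(j)}$, with the convention $v_{a,b}=v_{b,a}$ for $a>b$. The map $det^{S^2}:V^6\to k$ is defined, for $v_{i,j}=(\alpha_{i,j},\beta_{i,j})\in k^2$, by $$\begin{aligned} det^{S^2}\big((v_{i,j})_{1\leq i<j\leq 4}\big)=\;&\alpha_{1,2}\alpha_{2,3}\alpha_{3,4}\beta_{1,3}\beta_{2,4}\beta_{1,4}+\alpha_{1,2}\beta_{2,3}\alpha_{3,4}\beta_{1,3}\beta_{2,4}\alpha_{1,4}+\alpha_{1,2}\beta_{2,3}\beta_{3,4}\alpha_{1,3}\alpha_{2,4}\beta_{1,4}\\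 &+\beta_{1,2}\beta_{2,3}\alpha_{3,4}\alpha_{1,3}\alpha_{2,4}\beta_{1,4}+\beta_{1,2}\alpha_{2,3}\beta_{3,4}\beta_{1,3}\alpha_{2,4}\alpha_{1,4}+\beta_{1,2}\alpha_{2,3}\beta_{3,4}\alpha_{1,3}\beta_{2,4}\alpha_{1,4}\\ &-\beta_{1,2}\beta_{2,3}\beta_{3,4}\alpha_{1,3}\alpha_{2,4}\alpha_{1,4}-\beta_{1,2}\alpha_{2,3}\beta_{3,4}\alpha_{1,3}\alpha_{2,4}\beta_{1,4}-\beta_{1,2}\alpha_{2,3}\alpha_{3,4}\beta_{1,3}\beta_{2,4}\alpha_{1,4}\\ &-\alpha_{1,2}\alpha_{2,3}\beta_{3,4}\beta_{1,3}\beta_{2,4}\alpha_{1,4}-\alpha_{1,2}\beta_{2,3}\alpha_{3,4}\alpha_{1,3}\beta_{2,4}\beta_{1,4}-\alpha_{1,2}\beta_{2,3}\alpha_{3,4}\beta_{1,3}\alpha_{2,4}\beta_{1,4}. \end{aligned}$$ *)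

theory Defs
  imports "HOL-Analysis.Determinants" "HOL-Library.FuncSet"
begin

text \<open>
  The vector space \<open>V\<close> is the type \<open>'v\<close> with scalar multiplication
  \<open>s :: 'k \<Rightarrow> 'v \<Rightarrow> 'v\<close>. An ordered basis is a family indexed by the
  type \<open>2\<close>, so that coordinates live in \<open>'k ^ 2\<close>.
\<close>

definition ordered_basis :: "('k::field \<Rightarrow> 'v::ab_group_add \<Rightarrow> 'v) \<Rightarrow> (2 \<Rightarrow> 'v) \<Rightarrow> bool" where
  "ordered_basis s b \<longleftrightarrow>
     inj b \<and> \<not> module.dependent s (range b) \<and> module.span s (range b) = UNIV"

definition coords :: "('k::field \<Rightarrow> 'v::ab_group_add \<Rightarrow> 'v) \<Rightarrow> (2 \<Rightarrow> 'v) \<Rightarrow> 'v \<Rightarrow> 'k ^ 2" where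
  "coords s b v = (\<chi> i. module.representation s (range b) v (b i))"

text \<open>
  The library's \<^const>\<open>det\<close> is for matrices; the determinant of an endomorphism of \<open>V\<close> is that
  of its matrix in the chosen basis, whose column \<open>j\<close> holds the coordinates of \<open>T (b j)\<close>.
\<close>

definition endo_matrix ::
  "('k::field \<Rightarrow> 'v::ab_group_add \<Rightarrow> 'v) \<Rightarrow> (2 \<Rightarrow> 'v) \<Rightarrow> ('v \<Rightarrow> 'v) \<Rightarrow> 'k ^ 2 ^ 2" where
  "endo_matrix s b T = (\<chi> i j. coords s b (T (b j)) $ i)"

definition endo_det ::
  "('k::field \<Rightarrow> 'v::ab_group_add \<Rightarrow> 'v) \<Rightarrow> (2 \<Rightarrow> 'v) \<Rightarrow> ('v \<Rightarrow> 'v) \<Rightarrow> 'k" where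
  "endo_det s b T = det (endo_matrix s b T)"

definition SL2 :: "('k::field ^ 2 ^ 2) set" where
  "SL2 = {A. det A = 1}"

text \<open>A matrix acts on \<open>V\<close> by matrix-vector multiplication under the identification with \<open>'k ^ 2\<close>.\<close>

definition matrix_act ::
  "('k::field \<Rightarrow> 'v::ab_group_add \<Rightarrow> 'v) \<Rightarrow> (2 \<Rightarrow> 'v) \<Rightarrow> 'k ^ 2 ^ 2 \<Rightarrow> 'v \<Rightarrow> 'v" where
  "matrix_act s b A v = (\<Sum>i\<in>UNIV. s ((A *v coords s b v) $ i) (b i))"

text \<open>An element of \<open>V\<^sup>6\<close> is an extensional function on the six index pairs.\<close>

definition pairs4 :: "(nat \<times> nat) set" where
  "pairs4 = {(i, j). 1 \<le> i \<and> i < j \<and> j \<le> 4}"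

definition V6 :: "(nat \<times> nat \<Rightarrow> 'v) set" where
  "V6 = pairs4 \<rightarrow>\<^sub>E UNIV"

definition map_V6 :: "('v \<Rightarrow> 'v) \<Rightarrow> (nat \<times> nat \<Rightarrow> 'v) \<Rightarrow> nat \<times> nat \<Rightarrow> 'v" where
  "map_V6 T v = (\<lambda>p\<in>pairs4. T (v p))"

text \<open>The entry \<open>v\<^sub>a\<^sub>,\<^sub>b\<close> for arbitrary distinct \<open>a\<close>, \<open>b\<close>, with \<open>v\<^sub>a\<^sub>,\<^sub>b = v\<^sub>b\<^sub>,\<^sub>a\<close> if \<open>a > b\<close>.\<close>

definition sym_entry :: "(nat \<times> nat \<Rightarrow> 'v) \<Rightarrow> nat \<Rightarrow> nat \<Rightarrow> 'v" where
  "sym_entry v a b = (if a < b then v (a, b) else v (b, a))"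

definition perm_act :: "(nat \<Rightarrow> nat) \<Rightarrow> (nat \<times> nat \<Rightarrow> 'v) \<Rightarrow> nat \<times> nat \<Rightarrow> 'v" where
  "perm_act \<sigma> v = (\<lambda>(i, j)\<in>pairs4. sym_entry v (\<sigma> i) (\<sigma> j))"

definition detS2 ::
  "('k::field \<Rightarrow> 'v::ab_group_add \<Rightarrow> 'v) \<Rightarrow> (2 \<Rightarrow> 'v) \<Rightarrow> (nat \<times> nat \<Rightarrow> 'v) \<Rightarrow> 'k" where
  "detS2 s b v =
    (let \<alpha> = (\<lambda>i j. coords s b (v (i, j)) $ 1);
         \<beta> = (\<lambda>i j. coords s b (v (i, j)) $ 2)
     in \<alpha> 1 2 * \<alpha> 2 3 * \<alpha> 3 4 * \<beta> 1 3 * \<beta> 2 4 * \<beta> 1 4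
      + \<alpha> 1 2 * \<beta> 2 3 * \<alpha> 3 4 * \<beta> 1 3 * \<beta> 2 4 * \<alpha> 1 4
      + \<alpha> 1 2 * \<beta> 2 3 * \<beta> 3 4 * \<alpha> 1 3 * \<alpha> 2 4 * \<beta> 1 4
      + \<beta> 1 2 * \<beta> 2 3 * \<alpha> 3 4 * \<alpha> 1 3 * \<alpha> 2 4 * \<beta> 1 4
      + \<beta> 1 2 * \<alpha> 2 3 * \<beta> 3 4 * \<beta> 1 3 * \<alpha> 2 4 * \<alpha> 1 4
      + \<beta> 1 2 * \<alpha> 2 3 * \<beta> 3 4 * \<alpha> 1 3 * \<beta> 2 4 * \<alpha> 1 4
      - \<beta> 1 2 * \<beta> 2 3 * \<beta> 3 4 * \<alpha> 1 3 * \<alpha> 2 4 * \<alpha> 1 4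
      - \<beta> 1 2 * \<alpha> 2 3 * \<beta> 3 4 * \<alpha> 1 3 * \<alpha> 2 4 * \<beta> 1 4
      - \<beta> 1 2 * \<alpha> 2 3 * \<alpha> 3 4 * \<beta> 1 3 * \<beta> 2 4 * \<alpha> 1 4
      - \<alpha> 1 2 * \<alpha> 2 3 * \<beta> 3 4 * \<beta> 1 3 * \<beta> 2 4 * \<alpha> 1 4
      - \<alpha> 1 2 * \<beta> 2 3 * \<alpha> 3 4 * \<alpha> 1 3 * \<beta> 2 4 * \<beta> 1 4
      - \<alpha> 1 2 * \<beta> 2 3 * \<alpha> 3 4 * \<beta> 1 3 * \<alpha> 2 4 * \<beta> 1 4)"

end

theory Submission
  imports Defs
begin

text \<open>
  Write \<open>[x, y]\<close> for the determinant of two coordinate vectors. Then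
  \<open>det\<^sup>S\<^sup>2 = [v\<^sub>1\<^sub>2, v\<^sub>1\<^sub>3] [v\<^sub>2\<^sub>3, v\<^sub>3\<^sub>4] [v\<^sub>2\<^sub>4, v\<^sub>1\<^sub>4] + [v\<^sub>1\<^sub>2, v\<^sub>1\<^sub>4] [v\<^sub>2\<^sub>3, v\<^sub>1\<^sub>3] [v\<^sub>3\<^sub>4, v\<^sub>2\<^sub>4]\<close>.
  A linear map multiplies each bracket by its determinant, which gives (a). For (b) it
  suffices to treat transpositions, where the sign change is a polynomial identity.
\<close>

definition bracket :: "'k::comm_ring_1 ^ 2 \<Rightarrow> 'k ^ 2 \<Rightarrow> 'k" where
  "bracket x y = x $ 1 * y $ 2 - x $ 2 * y $ 1"

lemma bracket_matrix_vector_mult: "bracket (A *v x) (A *v y) = det A * bracket x y"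
  by (simp add: bracket_def det_2 matrix_vector_mult_def sum_2 algebra_simps)

text \<open>Expanding the brackets yields sixteen monomials. The two products share exactly two of
  them, with opposite signs: the one with \<alpha> at the positions 12, 23, 24 and the one with
  \<alpha> at the other three. The remaining twelve are those of the definition.\<close>

lemma detS2_eq_brackets:
  "detS2 s b v =
     (let c = (\<lambda>i j. coords s b (v (i, j)))
      in bracket (c 1 2) (c 1 3) * bracket (c 2 3) (c 3 4) * bracket (c 2 4) (c 1 4)
       + bracket (c 1 2) (c 1 4) * bracket (c 2 3) (c 1 3) * bracket (c 3 4) (c 2 4))"
  by (simp add: detS2_def bracket_def Let_def algebra_simps)

lemma pairs4_mem:
  "(1, 2) \<in> pairs4" "(1, 3) \<in> pairs4" "(1, 4) \<in> pairs4"
  "(2, 3) \<in> pairs4" "(2, 4) \<in> pairs4" "(3, 4) \<in> pairs4"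
  by (simp_all add: pairs4_def)

text \<open>Allows \<open>perm_act id v\<close>, which is \<open>undefined\<close> off
  \<open>pairs4\<close>, to be compared with an arbitrary \<open>v\<close>.\<close>

lemma detS2_cong:
  assumes "\<And>p. p \<in> pairs4 \<Longrightarrow> v p = w p"
  shows "detS2 s b v = detS2 s b w"
  unfolding detS2_eq_brackets by (simp only: assms pairs4_mem Let_def)

text \<open>Common core of both claims in (a). The cube appears because each of the two products
  consists of three brackets.\<close>

lemma detS2_map_V6:
  assumes "\<And>x. coords s b (T x) = A *v coords s b x"
  shows "detS2 s b (map_V6 T v) = det A ^ 3 * detS2 s b v"
  \<comment> \<open>Brackets stay folded here, so each one contributes a factor \<open>det A\<close>
    without expansion into coordinates.\<close>
  by (simp only: detS2_eq_brackets map_V6_def restrict_apply pairs4_mem if_True assms Let_def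
      bracket_matrix_vector_mult) (simp add: algebra_simps power3_eq_cube)

lemma coords_add:
  assumes "vector_space s" "ordered_basis s b"
  shows "coords s b (x + y) = coords s b x + coords s b y"
proof -
  interpret vector_space s by fact
  show ?thesis
    using assms(2) by (simp add: ordered_basis_def coords_def vec_eq_iff representation_add)
qed

lemma coords_scale:
  assumes "vector_space s" "ordered_basis s b"
  shows "coords s b (s c x) = c *s coords s b x"
proof -
  interpret vector_space s by fact
  show ?thesis
    using assms(2) by (simp add: ordered_basis_def coords_def vec_eq_iff representation_scale)
qed

lemma coords_basis:
  assumes "vector_space s" "ordered_basis s b"
  shows "coords s b (b j) = axis j 1"
proof -
  interpret vector_space s by fact
  show ?thesis
    using assms(2)
    by (auto simp: ordered_basis_def coords_def vec_eq_iff representation_basis axis_def inj_eq)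
qed

lemma sum_coords:
  assumes "vector_space s" "ordered_basis s b"
  shows "(\<Sum>i\<in>UNIV. s (coords s b x $ i) (b i)) = x"
proof -
  interpret vector_space s by fact
  have b: "inj b" "independent (range b)" "span (range b) = UNIV"
    using assms(2) by (auto simp: ordered_basis_def)
  have "(\<Sum>i\<in>UNIV. s (coords s b x $ i) (b i)) = (\<Sum>w\<in>range b. s (representation (range b) x w) w)"
    using b(1) by (simp add: coords_def sum.reindex)
  also have "\<dots> = x"
    using b by (intro sum_representation_eq) auto
  finally show ?thesis .
qed

text \<open>Expand \<open>x\<close> in the basis and pull \<open>T\<close> through the sum: the
  coordinates of the vectors \<open>T (b i)\<close> are the columns of the matrix.\<close>

lemma coords_linear:
  assumes "vector_space s" "ordered_basis s b" "Vector_Spaces.linear s s T"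
  shows "coords s b (T x) = endo_matrix s b T *v coords s b x"
proof -
  interpret T: Vector_Spaces.linear s s T by fact
  have "T x = T (\<Sum>i\<in>UNIV. s (coords s b x $ i) (b i))"
    using sum_coords[OF assms(1,2)] by simp
  also have "\<dots> = (\<Sum>i\<in>UNIV. s (coords s b x $ i) (T (b i)))"
    by (simp add: T.sum T.scale)
  finally show ?thesis
    by (simp add: sum_2 coords_add[OF assms(1,2)] coords_scale[OF assms(1,2)] vec_eq_iff
        matrix_vector_mult_def endo_matrix_def mult.commute)
qed

lemma coords_matrix_act:
  assumes "vector_space s" "ordered_basis s b"
  shows "coords s b (matrix_act s b A x) = A *v coords s b x"
  by (simp add: matrix_act_def sum_2 coords_add[OF assms] coords_scale[OF assms]
      coords_basis[OF assms] vec_eq_iff forall_2 axis_def)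

lemma detS2_perm_act_id: "detS2 s b (perm_act id v) = detS2 s b v"
  by (rule detS2_cong) (auto simp: perm_act_def sym_entry_def pairs4_def)

lemma sym_entry_commute: "sym_entry v i j = sym_entry v j i"
  by (simp add: sym_entry_def)

lemma perm_act_apply: "(i, j) \<in> pairs4 \<Longrightarrow> perm_act \<sigma> v (i, j) = sym_entry v (\<sigma> i) (\<sigma> j)"
  by (simp add: perm_act_def)

text \<open>Extends the defining formula of the action to pairs in either order, since a permutation
  may reverse the order of a pair.\<close>

lemma sym_entry_perm_act:
  assumes "i \<in> {1..4}" "j \<in> {1..4}" "i \<noteq> j"
  shows "sym_entry (perm_act \<sigma> v) i j = sym_entry v (\<sigma> i) (\<sigma> j)"
proof (cases "i < j")
  case True
  then have "(i, j) \<in> pairs4" using assms by (simp add: pairs4_def)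
  then show ?thesis using True by (simp add: sym_entry_def perm_act_apply)
next
  case False
  then have "(j, i) \<in> pairs4" using assms by (simp add: pairs4_def)
  then show ?thesis using False by (simp add: sym_entry_def[of "perm_act \<sigma> v"] perm_act_apply
    sym_entry_commute[of v "\<sigma> i"])
qed

text \<open>This is a right action: \<open>\<tau>\<close> acts on the family first. As
  \<open>\<sigma>\<close> keeps indices distinct and within \<open>{1..4}\<close>, the inner
  symmetric entry can be evaluated at their images.\<close>

lemma perm_act_comp:
  assumes "\<sigma> permutes {1..4}"
  shows "perm_act (\<tau> \<circ> \<sigma>) v = perm_act \<sigma> (perm_act \<tau> v)"
proof
  fix p :: "nat \<times> nat"
  obtain i j where p: "p = (i, j)" by (cases p)
  show "perm_act (\<tau> \<circ> \<sigma>) v p = perm_act \<sigma> (perm_act \<tau> v) p"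
  proof (cases "p \<in> pairs4")
    case True
    then have "i \<in> {1..4}" "j \<in> {1..4}" "i \<noteq> j" by (auto simp: p pairs4_def)
    then have "\<sigma> i \<in> {1..4}" "\<sigma> j \<in> {1..4}" "\<sigma> i \<noteq> \<sigma> j"
      using assms by (simp_all only: permutes_in_image inj_eq[OF permutes_inj[OF assms]] not_False_eq_True)
    then have "sym_entry (perm_act \<tau> v) (\<sigma> i) (\<sigma> j) = sym_entry v (\<tau> (\<sigma> i)) (\<tau> (\<sigma> j))"
      by (rule sym_entry_perm_act)
    then show ?thesis
      using True by (simp add: p perm_act_apply)
  qed (simp add: perm_act_def)
qed

text \<open>Each of the six transpositions permutes the variables so that the six positive monomials
  and the six negative ones are interchanged.\<close>

lemma detS2_perm_act_transpose_less:
  assumes "(i, j) \<in> pairs4"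
  shows "detS2 s b (perm_act (Transposition.transpose i j) v) = - detS2 s b v"
proof -
  have "(i, j) \<in> {(1, 2), (1, 3), (1, 4), (2, 3), (2, 4), (3, 4)}"
    using assms by (auto simp: pairs4_def)
  then show ?thesis
    unfolding detS2_def
    by (elim insertE emptyE; simp only: Let_def perm_act_apply pairs4_mem prod.inject;
        simp add: Transposition.transpose_def sym_entry_def algebra_simps)
qed

lemma detS2_perm_act_transpose:
  assumes "i \<in> {1..4}" "j \<in> {1..4}" "i \<noteq> j"
  shows "detS2 s b (perm_act (Transposition.transpose i j) v) = - detS2 s b v"
proof (cases "i < j")
  case True
  then show ?thesis using assms by (intro detS2_perm_act_transpose_less) (simp add: pairs4_def)
next
  case False
  then show ?thesis
    using assms by (subst Transposition.transpose_commute, intro detS2_perm_act_transpose_less)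
      (simp add: pairs4_def)
qed

lemma detS2_perm_act:
  assumes "\<sigma> permutes {1..4}"
  shows "detS2 s b (perm_act \<sigma> v) = of_int (sign \<sigma>) * detS2 s b v"
  using assms finite_atLeastAtMost
\<comment> \<open>The family \<open>v\<close> must vary: for
  \<open>Transposition.transpose i j \<circ> p\<close> the induction hypothesis is applied to the
  family already moved by the transposition.\<close>
proof (induction arbitrary: v rule: permutes_induct)
  case id
  then show ?case by (simp add: detS2_perm_act_id[unfolded id_def] sign_id id_def)
next
  case (swap i j p)
  have "permutation p" using swap.hyps by (auto simp: permutation_permutes)
  then have "sign (Transposition.transpose i j \<circ> p) = - sign p"
    using swap.hyps by (simp add: sign_compose permutation_swap_id sign_swap_id)
  then show ?case
    by (simp only: perm_act_comp[OF swap.hyps(4)] swap.IH detS2_perm_act_transpose[OF swap.hyps(1-3)]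
        of_int_minus mult_minus_left mult_minus_right)
qed

theorem lemma3p1:
  fixes s :: "'k::field_char_0 \<Rightarrow> 'v::ab_group_add \<Rightarrow> 'v"
    and b :: "2 \<Rightarrow> 'v"
    and v :: "nat \<times> nat \<Rightarrow> 'v"
  assumes "vector_space s"
    and "vector_space.dim s (UNIV :: 'v set) = 2"
    and "ordered_basis s b"
    and "v \<in> V6"
  shows "(\<forall>T. Vector_Spaces.linear s s T \<longrightarrow>
              detS2 s b (map_V6 T v) = endo_det s b T ^ 3 * detS2 s b v)
       \<and> (\<forall>A\<in>SL2. detS2 s b (map_V6 (matrix_act s b A) v) = detS2 s b v)
       \<and> (\<forall>\<sigma>. \<sigma> permutes {1..4} \<longrightarrow>
              detS2 s b (perm_act \<sigma> v) = of_int (sign \<sigma>) * detS2 s b v)"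
proof (intro conjI allI impI ballI)
  fix T assume "Vector_Spaces.linear s s T"
  then show "detS2 s b (map_V6 T v) = endo_det s b T ^ 3 * detS2 s b v"
    unfolding endo_det_def by (intro detS2_map_V6 coords_linear assms)
next
  fix A :: "'k ^ 2 ^ 2" assume "A \<in> SL2"
  then show "detS2 s b (map_V6 (matrix_act s b A) v) = detS2 s b v"
    \<comment> \<open>The coordinate form of the action gives the factor
      \<open>det A ^ 3 = 1\<close> directly, without passing through
      \<open>endo_det\<close>.\<close>
    using detS2_map_V6[of s b "matrix_act s b A" A v] coords_matrix_act[OF assms(1,3)]
    by (simp add: SL2_def)
next
  fix \<sigma> :: "nat \<Rightarrow> nat" assume "\<sigma> permutes {1..4}"
  then show "detS2 s b (perm_act \<sigma> v) = of_int (sign \<sigma>) * detS2 s b v"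
    by (rule detS2_perm_act)
qed

end
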